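(* Let $r,l\in\mathbb{N}$, let $m,n_1,\ldots,n_r\in\mathbb{N}_0$, and let $b_1,\ldots,b_r,d\in\mathbb{C}$. Assume that $(1-d)_{m+l}\neq 0$, that $(b_q-n_q)_m\neq 0$ for $q=1,\ldots,r$, and that $m+l=n_1+\cdots+n_r$. Then the terminating hypergeometric series $$ {}_{r+2}F_{r+1}\!\left[\begin{matrix}-m,\ b_1,\ldots,b_r,\ 1-d\\ b_1-n_1,\ldots,b_r-n_r,\ 1-d+l\end{matrix};1\right] $$ is zero-balanced, and it satisfies $$ {}_{r+2}F_{r+1}\!\left[\begin{matrix}-m,\ b_1,\ldots,b_r,\ 1-d\\ b_1-n_1,\ldots,b_r-n_r,\ 1-d+l\end{matrix};1\right] =\frac{(1-d)_l}{(1-d)_{m+l}}\sum_{j=0}^{m}\binom{m}{j}(l)_{m-j}(1-d)_j\; {}_{r+1}F_r\!\left[\begin{matrix}-j,\ b_1,\ldots,b_r\\ b_1-n_1,\ldots,b_r-n_r\end{matrix};1\right]. $$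
   Context: $\mathbb{N}=\{1,2,\ldots\}$ and $\mathbb{N}_0=\{0,1,2,\ldots\}$. Shifted factorial: $(\alpha)_0=1$ and $(\alpha)_n=\prod_{i=0}^{n-1}(\alpha+i)$ for $n\ge1$. For $N\in\mathbb{N}_0$, the terminating hypergeometric series at argument $1$ with numerator parameter $-N$ is the finite sum $$ {}_{s+1}F_s\!\left[\begin{matrix}-N,\ a_1,\ldots,a_s\\ c_1,\ldots,c_s\end{matrix};1\right]=\sum_{k=0}^{N}\frac{(-N)_k(a_1)_k\cdots(a_s)_k}{(c_1)_k\cdots(c_s)_k}\frac{1}{k!}. $$ A hypergeometric series is called zero-balanced if the sum of its denominator (lower) parameters minus the sum of its numerator (upper) parameters equals $0$; for the series just displayed this means $\sum_{i=1}^{s}c_i-\left(-N+\sum_{i=1}^{s}a_i\right)=0$. *)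

theory Defs
  imports Complex_Main
begin

text \<open>
  The terminating series with numerator parameters \<open>-N, a\<^sub>1, \<dots>, a\<^sub>s\<close> and denominator
  parameters \<open>c\<^sub>1, \<dots>, c\<^sub>s\<close> at argument 1. The parameter \<open>-N\<close> is not listed in \<open>as\<close>.
  The value is meaningful only if no \<open>pochhammer c\<^sub>i k\<close> with \<open>k \<le> N\<close> vanishes.
\<close>

definition hyp_terminating :: "nat \<Rightarrow> complex list \<Rightarrow> complex list \<Rightarrow> complex" where
  "hyp_terminating N as cs =
     (\<Sum>k=0..N. pochhammer (- of_nat N) k * (\<Prod>a\<leftarrow>as. pochhammer a k)
                 / (\<Prod>c\<leftarrow>cs. pochhammer c k) * (1 / fact k))"

text \<open>Here \<open>upper\<close> lists all numerator parameters, including a terminating one.\<close>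

definition zero_balanced :: "complex list \<Rightarrow> complex list \<Rightarrow> bool" where
  "zero_balanced upper lower \<longleftrightarrow> sum_list lower - sum_list upper = 0"

end

theory Submission
  imports Defs
begin

text \<open>
  Write \<open>e = 1 - d\<close>. The identity is a termwise comparison: each \<open>k\<close>-th summand of the
  series on the left occurs, stripped of its factors that contain \<open>m\<close> and \<open>e\<close>, in every
  inner series on the right with \<open>j \<ge> k\<close>. After exchanging the two summations on the right it
  suffices to compute
  \<open>\<Sum>j=k..m. (m choose j) (l)\<^sub>m\<^sub>-\<^sub>j (e)\<^sub>j (-j)\<^sub>k\<close>.
  The trinomial revision \<open>(m choose j) (-j)\<^sub>k = (-m)\<^sub>k (m-k choose j-k)\<close> and the splitting
  \<open>(e)\<^sub>j = (e)\<^sub>k (e+k)\<^sub>j\<^sub>-\<^sub>k\<close> turn it into a Chu-Vandermonde sum, with value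
  \<open>(-m)\<^sub>k (e)\<^sub>k (e+l+k)\<^sub>m\<^sub>-\<^sub>k\<close> (lemma \<open>pochhammer_convolution\<close>).
  Finally \<open>(e)\<^sub>m\<^sub>+\<^sub>l = (e)\<^sub>l (e+l)\<^sub>k (e+l+k)\<^sub>m\<^sub>-\<^sub>k\<close>, so the prefactor
  \<open>(e)\<^sub>l / (e)\<^sub>m\<^sub>+\<^sub>l\<close> leaves exactly the quotient \<open>(e)\<^sub>k / (e+l)\<^sub>k\<close> contributed by the
  additional pair of parameters.

  This computation treats the remaining parameters as arbitrary lists. In the parameter balance
  all \<open>b\<^sub>q\<close> and \<open>d\<close> cancel, and \<open>m + l - (n\<^sub>1 + \<dots> + n\<^sub>r) = 0\<close> is what remains.
\<close>

lemma pochhammer_neg_of_nat_choose: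
  "pochhammer (- of_nat j :: complex) k = (- 1) ^ k * fact k * of_nat (j choose k)"
  by (simp add: binomial_gbinomial gbinomial_pochhammer flip: power_add mult_2)

text \<open>
  Since \<open>(-j)\<^sub>k\<close> is \<open>j choose k\<close> up to a factor independent of \<open>j\<close>, this is the revision
  \<open>(m choose j) (j choose k) = (m choose k) (m-k choose j-k)\<close>.
\<close>

lemma choose_mult_pochhammer_neg:
  assumes "k \<le> j" and "j \<le> m"
  shows "of_nat (m choose j) * pochhammer (- of_nat j :: complex) k
       = pochhammer (- of_nat m) k * of_nat ((m - k) choose (j - k))"
proof -
  have "(of_nat (m choose j) :: complex) * of_nat (j choose k)
      = of_nat (m choose k) * of_nat ((m - k) choose (j - k))"
    using choose_mult[OF assms] by (metis of_nat_mult)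
  then show ?thesis
    unfolding pochhammer_neg_of_nat_choose by (simp add: mult_ac)
qed

text \<open>
  Chu-Vandermonde for \<open>(e+k)\<close> and \<open>x\<close> of order \<open>m - k\<close>: the factor \<open>(-j)\<^sub>k\<close> kills all
  \<open>j < k\<close> and turns \<open>m choose j\<close> into \<open>m-k choose j-k\<close>.
\<close>

lemma pochhammer_convolution:
  fixes e x :: complex
  assumes "k \<le> m"
  shows "(\<Sum>j=k..m. of_nat (m choose j) * pochhammer x (m - j) * pochhammer e j
                       * pochhammer (- of_nat j) k)
       = pochhammer (- of_nat m) k * pochhammer e k * pochhammer (e + x + of_nat k) (m - k)"
    (is "?lhs = _")
proof -
  have "?lhs = (\<Sum>j=k..m. pochhammer (- of_nat m) k * pochhammer e k
                  * (of_nat ((m - k) choose (j - k)) * pochhammer (e + of_nat k) (j - k)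
                     * pochhammer x (m - j)))"
  proof (rule sum.cong[OF refl])
    fix j assume j: "j \<in> {k..m}"
    then show "of_nat (m choose j) * pochhammer x (m - j) * pochhammer e j
                 * pochhammer (- of_nat j) k
             = pochhammer (- of_nat m) k * pochhammer e k
                 * (of_nat ((m - k) choose (j - k)) * pochhammer (e + of_nat k) (j - k)
                    * pochhammer x (m - j))"
      using choose_mult_pochhammer_neg[of k j m] pochhammer_product[of k j e]
      by (simp add: mult_ac)
  qed
  also have "\<dots> = pochhammer (- of_nat m) k * pochhammer e k
                  * (\<Sum>i\<le>m - k. of_nat ((m - k) choose i) * pochhammer (e + of_nat k) i
                     * pochhammer x (m - k - i))"
    unfolding sum_distrib_left
    by (rule sum.reindex_bij_witness[where i = "\<lambda>i. i + k" and j = "\<lambda>j. j - k"])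
       (use assms in auto)
  also have "(\<Sum>i\<le>m - k. of_nat ((m - k) choose i) * pochhammer (e + of_nat k) i
                     * pochhammer x (m - k - i))
           = pochhammer (e + of_nat k + x) (m - k)"
    by (rule pochhammer_binomial_sum[symmetric])
  finally show ?thesis
    by (simp add: add_ac)
qed

text \<open>
  Removing a parameter pair whose entries differ by a nonnegative integer: the quotient
  \<open>(e)\<^sub>k / (e+l)\<^sub>k\<close> has the numerator \<open>(e)\<^sub>k (e+l+k)\<^sub>m\<^sub>-\<^sub>k\<close> over a denominator that does not
  depend on \<open>k\<close>, and \<open>pochhammer_convolution\<close> expands this numerator so that \<open>m\<close> is
  replaced by the summation index \<open>j\<close> in the terminating parameter.
\<close>

lemma hyp_terminating_parameter_pair:
  assumes nz: "pochhammer e (m + l) \<noteq> 0"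
  shows "hyp_terminating m (as @ [e]) (cs @ [e + of_nat l])
       = pochhammer e l / pochhammer e (m + l)
         * (\<Sum>j=0..m. of_nat (m choose j) * pochhammer (of_nat l) (m - j) * pochhammer e j
              * hyp_terminating j as cs)"
proof -
  define t where "t k = (\<Prod>a\<leftarrow>as. pochhammer a k) / (\<Prod>c\<leftarrow>cs. pochhammer c k) * (1 / fact k)"
    for k
  define w where "w j = of_nat (m choose j) * pochhammer (of_nat l) (m - j) * pochhammer e j"
    for j
  have "(\<Sum>j=0..m. w j * hyp_terminating j as cs)
      = (\<Sum>j=0..m. \<Sum>k=0..j. w j * pochhammer (- of_nat j) k * t k)"
    by (simp add: hyp_terminating_def t_def sum_distrib_left mult_ac)
  also have "\<dots> = (\<Sum>k=0..m. \<Sum>j=k..m. w j * pochhammer (- of_nat j) k * t k)"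
    unfolding sum.Sigma[OF finite_atLeastAtMost ballI[OF finite_atLeastAtMost]]
    by (rule sum.reindex_bij_witness[where i = prod.swap and j = prod.swap]) auto
  also have "\<dots> = (\<Sum>k=0..m. pochhammer (- of_nat m) k * pochhammer e k
                       * pochhammer (e + of_nat l + of_nat k) (m - k) * t k)"
    by (intro sum.cong refl)
       (simp add: w_def pochhammer_convolution flip: sum_distrib_right)
  finally have inner: "(\<Sum>j=0..m. w j * hyp_terminating j as cs)
      = (\<Sum>k=0..m. pochhammer (- of_nat m) k * pochhammer e k
                     * pochhammer (e + of_nat l + of_nat k) (m - k) * t k)" .
  have ratio: "pochhammer e k / pochhammer (e + of_nat l) k
      = pochhammer e l / pochhammer e (m + l)
        * (pochhammer e k * pochhammer (e + of_nat l + of_nat k) (m - k))"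
    if "k \<le> m" for k
  proof -
    have "pochhammer e (m + l) = pochhammer e l * (pochhammer (e + of_nat l) k
            * pochhammer (e + of_nat l + of_nat k) (m - k))"
      using pochhammer_product'[of e l m] pochhammer_product[OF that, of "e + of_nat l"]
      by (simp add: add.commute)
    then show ?thesis
      using nz by (simp add: divide_simps)
  qed
  have "hyp_terminating m (as @ [e]) (cs @ [e + of_nat l])
      = (\<Sum>k=0..m. pochhammer (- of_nat m) k * t k
                     * (pochhammer e k / pochhammer (e + of_nat l) k))"
    by (simp add: hyp_terminating_def t_def mult_ac)
  also have "\<dots> = (\<Sum>k=0..m. pochhammer e l / pochhammer e (m + l)
                     * (pochhammer (- of_nat m) k * pochhammer e k
                     * pochhammer (e + of_nat l + of_nat k) (m - k) * t k))"
    by (intro sum.cong refl) (simp add: ratio)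
  also have "\<dots> = pochhammer e l / pochhammer e (m + l)
      * (\<Sum>j=0..m. w j * hyp_terminating j as cs)"
    unfolding inner sum_distrib_left ..
  finally show ?thesis
    unfolding w_def .
qed

theorem corollary3p9:
  fixes r l m :: nat and n :: "nat \<Rightarrow> nat" and b :: "nat \<Rightarrow> complex" and d :: complex
  assumes "r \<ge> 1" and "l \<ge> 1"
    and "pochhammer (1 - d) (m + l) \<noteq> 0"
    and "\<And>q. q \<in> {1..r} \<Longrightarrow> pochhammer (b q - of_nat (n q)) m \<noteq> 0"
    and "m + l = (\<Sum>q=1..r. n q)"
  shows "zero_balanced
           (- of_nat m # map b [1..<Suc r] @ [1 - d])
           (map (\<lambda>q. b q - of_nat (n q)) [1..<Suc r] @ [1 - d + of_nat l])
       \<and> hyp_terminating m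
           (map b [1..<Suc r] @ [1 - d])
           (map (\<lambda>q. b q - of_nat (n q)) [1..<Suc r] @ [1 - d + of_nat l])
         = pochhammer (1 - d) l / pochhammer (1 - d) (m + l)
           * (\<Sum>j=0..m. of_nat (m choose j) * pochhammer (of_nat l) (m - j) * pochhammer (1 - d) j
                * hyp_terminating j
                    (map b [1..<Suc r])
                    (map (\<lambda>q. b q - of_nat (n q)) [1..<Suc r]))"
proof
  have "(\<Sum>q\<leftarrow>[1..<Suc r]. b q - of_nat (n q))
      = (\<Sum>q\<leftarrow>[1..<Suc r]. b q) - of_nat (m + l)"
    unfolding assms(5)
    by (simp add: sum_list_subtractf interv_sum_list_conv_sum_set_nat
        atLeastLessThanSuc_atLeastAtMost del: upt_Suc)
  then show "zero_balanced
           (- of_nat m # map b [1..<Suc r] @ [1 - d])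
           (map (\<lambda>q. b q - of_nat (n q)) [1..<Suc r] @ [1 - d + of_nat l])"
    unfolding zero_balanced_def by (simp del: upt_Suc)
qed (rule hyp_terminating_parameter_pair[OF assms(3)])

end
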